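(* Let $p > 3$ be a prime, and let $d = \mathrm{ord}_p(2)$ be the multiplicative order of $2$ modulo $p$. Then for every even integer $k \geq 6$ and every integer $n \geq 0$, we have $$b_k\left( 2^{dp} n + 2^{dp-1} \right) \equiv 0 \pmod{p}.$$
   Context: For an integer $j$ write $\sigma_j(n) := \sum_{d \mid n} d^j$, the sum over positive divisors of $n \ge 1$. For even $k \geq 6$ and integers $n \geq 1$ define $$b_6(n) := \frac{(n^2-n+1)\sigma_1(n) - \sigma_3(n)}{6}, \qquad b_k(n) := \frac{-n^2\sigma_{k-7}(n) + (n^2+1)\sigma_{k-5}(n) - \sigma_{k-3}(n)}{24} \quad (k \geq 8).$$ These numbers are integers for all $n\ge 1$. *)

theory Defs
  imports Complex_Main "HOL-Number_Theory.Number_Theory"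
begin

(* Natural-number exponents suffice: only odd j >= 1 occur below. *)
definition divisor_sigma :: "nat \<Rightarrow> nat \<Rightarrow> nat" where
  "divisor_sigma j n = (\<Sum>d | d dvd n. d ^ j)"

(* The value is taken in the rationals, so that "/" is exact division and no truncation can
   occur. Only even k >= 6 and n >= 1 are meaningful: for k < 6 the truncated exponents and
   for n = 0 the infinite set of divisors give junk values. *)
definition b_num :: "nat \<Rightarrow> nat \<Rightarrow> rat" where
  "b_num k n =
     (if k = 6 then
        ((of_nat n ^ 2 - of_nat n + 1) * of_nat (divisor_sigma 1 n)
          - of_nat (divisor_sigma 3 n)) / 6
      else
        (- (of_nat n ^ 2) * of_nat (divisor_sigma (k - 7) n)
          + (of_nat n ^ 2 + 1) * of_nat (divisor_sigma (k - 5) n)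
          - of_nat (divisor_sigma (k - 3) n)) / 24)"

end

theory Submission
  imports Defs
begin

text \<open>
  Write \<open>N = 2 ^ (d * p) * n + 2 ^ (d * p - 1) = 2 ^ (d * p - 1) * (2 * n + 1)\<close>. Multiplicativity
  gives the factor \<open>1 + x + \<dots> + x ^ (d * p - 1)\<close> with \<open>x = 2 ^ j\<close> in \<open>\<sigma>\<^sub>j(N)\<close>; modulo \<open>p\<close> its
  summands have period \<open>d\<close>, so it is \<open>p\<close> times a sum over one period. Hence \<open>p\<close> divides every
  \<open>\<sigma>\<^sub>j(N)\<close>, and therefore the numerators of \<open>b\<^sub>k(N)\<close>, whose denominators 6 and 24 are prime
  to \<open>p\<close>.

  Integrality for \<open>k \<ge> 8\<close> holds divisor by divisor: with \<open>j = k - 7\<close>, the divisor \<open>e\<close> of \<open>N\<close>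
  contributes \<open>e ^ j * (e\<^sup>2 - 1) * (N\<^sup>2 - e\<^sup>2)\<close> to the numerator. For \<open>k = 6\<close> the numerator is
  \<open>N * (N - 1) * \<sigma>\<^sub>1(N)\<close> modulo 6, and if \<open>N \<equiv> 2\<close> modulo 3, pairing \<open>e\<close> with \<open>N div e\<close> shows that
  3 divides \<open>\<sigma>\<^sub>1(N)\<close>.
\<close>

text \<open>Induction on \<open>a\<close>: a divisor of \<open>q ^ Suc a * M\<close> is either prime
  to \<open>q\<close>, hence a divisor of \<open>M\<close>, or \<open>q\<close> times a divisor of
  \<open>q ^ a * M\<close>. The cases are disjoint because \<open>q\<close> does not divide
  \<open>M\<close>.\<close>

lemma divisor_sigma_prime_power_mult:
  assumes "prime q" and "\<not> q dvd M"
  shows "divisor_sigma j (q ^ a * M) = (\<Sum>i\<le>a. (q ^ j) ^ i) * divisor_sigma j M"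
proof (induction a)
  case 0
  show ?case by simp
next
  case (Suc a)
  have pos: "M > 0" "q > 0"
    using assms by (auto intro: Nat.gr0I simp: prime_gt_0_nat)
  have split: "{e. e dvd q ^ Suc a * M} = {e. e dvd M} \<union> (*) q ` {e. e dvd q ^ a * M}" (is "?L = ?R")
  proof (intro equalityI subsetI)
    fix e assume e: "e \<in> ?L"
    show "e \<in> ?R"
    proof (cases "q dvd e")
      case True
      then obtain f where "e = q * f" ..
      with e pos show ?thesis by (auto simp: mult.assoc)
    next
      case False
      then have "coprime e (q ^ Suc a)"
        using assms(1) by (metis coprime_commute coprime_power_right_iff prime_imp_coprime)
      with e show ?thesis by (simp add: coprime_dvd_mult_right_iff)
    qed
  qed (auto simp: mult.assoc)
  have disj: "{e. e dvd M} \<inter> (*) q ` {e. e dvd q ^ a * M} = {}"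
    using assms(2) by (auto dest: dvd_mult_left)
  have "divisor_sigma j (q ^ Suc a * M) =
      divisor_sigma j M + (\<Sum>e\<in>(*) q ` {e. e dvd q ^ a * M}. e ^ j)"
    unfolding divisor_sigma_def split using disj pos
    by (subst sum.union_disjoint) auto
  also have "(\<Sum>e\<in>(*) q ` {e. e dvd q ^ a * M}. e ^ j) = q ^ j * divisor_sigma j (q ^ a * M)"
    unfolding divisor_sigma_def using pos
    by (subst sum.reindex) (auto simp: inj_on_def power_mult_distrib sum_distrib_left)
  finally show ?case
    by (simp only: Suc.IH) (simp add: sum.atMost_Suc_shift sum_distrib_left sum_distrib_right
        algebra_simps del: sum.atMost_Suc)
qed

lemma dvd_geometric_sum:
  fixes p d x :: nat
  assumes "[x ^ d = 1] (mod p)"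
  shows "p dvd (\<Sum>i<d * p. x ^ i)"
proof -
  have split: "(\<Sum>i<a + b. x ^ i) = (\<Sum>i<a. x ^ i) + (\<Sum>i<b. x ^ (a + i))" for a b
    by (induction b) simp_all
  \<comment> \<open>Generalised from \<open>p\<close> to \<open>m\<close> blocks of length
    \<open>d\<close>, so that the induction adds one block at a time.\<close>
  have "[(\<Sum>i<d * m. x ^ i) = m * (\<Sum>i<d. x ^ i)] (mod p)" for m
  proof (induction m)
    case 0
    show ?case by simp
  next
    case (Suc m)
    have "(\<Sum>i<d * Suc m. x ^ i) = (\<Sum>i<d * m. x ^ i) + (x ^ d) ^ m * (\<Sum>i<d. x ^ i)"
      by (simp add: split sum_distrib_left power_add power_mult add.commute[of d])
    moreover have "[(x ^ d) ^ m * (\<Sum>i<d. x ^ i) = 1 * (\<Sum>i<d. x ^ i)] (mod p)"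
      using cong_pow[OF assms, of m] by (intro cong_mult) auto
    ultimately show ?case
      using cong_add[OF Suc.IH, of "(x ^ d) ^ m * (\<Sum>i<d. x ^ i)" "\<Sum>i<d. x ^ i"]
      by (simp add: algebra_simps)
  qed
  from this[of p] show ?thesis
    using cong_dvd_iff dvd_triv_left by blast
qed

lemma three_dvd_cube_minus: "(3::int) dvd x * (x\<^sup>2 - 1)"
proof -
  have "3 dvd x \<or> 3 dvd x - 1 \<or> 3 dvd x + 1" by presburger
  moreover have "x * (x\<^sup>2 - 1) = x * (x - 1) * (x + 1)"
    by (simp add: power2_eq_square algebra_simps)
  ultimately show ?thesis by (metis dvd_mult dvd_mult2)
qed

lemma six_dvd_cube_minus: "(6::int) dvd x ^ 3 - x"
proof -
  have "3 dvd x ^ 3 - x"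
    using three_dvd_cube_minus[of x] by (simp add: algebra_simps eval_nat_numeral)
  moreover have "2 dvd x ^ 3 - x" by simp
  ultimately show ?thesis
    using divides_mult[of 3 _ "2::int"] by simp
qed

lemma three_dvd_divisor_sigma_1:
  assumes "N mod 3 = 2"
  shows "3 dvd divisor_sigma 1 N"
proof -
  have pos: "N > 0" using assms by (auto intro: Nat.gr0I)
  have pair: "3 dvd e + N div e" if "e dvd N" for e
  proof -
    from that obtain f where f: "N = e * f" ..
    have "e mod 3 = 0 \<or> e mod 3 = 1 \<or> e mod 3 = 2" "f mod 3 = 0 \<or> f mod 3 = 1 \<or> f mod 3 = 2"
      by presburger+
    \<comment> \<open>This forces the residues of \<open>e\<close> and \<open>f\<close> to be 1 and
      2 in some order.\<close>
    moreover have "(e mod 3) * (f mod 3) mod 3 = 2"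
      using assms f by (simp add: mod_mult_eq)
    ultimately have "(e + f) mod 3 = 0"
      by (auto simp: mod_add_eq[symmetric, of e])
    then show ?thesis using f pos by auto
  qed
  have "divisor_sigma 1 N = (\<Sum>e | e dvd N. N div e)"
    unfolding divisor_sigma_def
    by (rule sum.reindex_bij_witness[of _ "(div) N" "(div) N"])
       (use pos in \<open>auto simp: div_div_eq_right elim!: dvdE\<close>)
  \<comment> \<open>Adding the sum to its reindexed copy avoids choosing one divisor from each pair;
    the factor 2 is invertible modulo 3.\<close>
  then have "2 * divisor_sigma 1 N = (\<Sum>e | e dvd N. e + N div e)"
    by (simp add: divisor_sigma_def sum.distrib)
  also have "3 dvd \<dots>" by (rule dvd_sum) (use pair in auto)
  finally show ?thesis by presburger
qed

lemma six_dvd_b_6_numerator: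
  "(6::int) dvd (int N ^ 2 - int N + 1) * int (divisor_sigma 1 N) - int (divisor_sigma 3 N)"
proof -
  \<comment> \<open>Since \<open>e ^ 3\<close> and \<open>e\<close> agree modulo 6, so do
    \<sigma>_3(N) and \<sigma>_1(N).\<close>
  have "6 dvd (\<Sum>e | e dvd N. int e ^ 3 - int e)"
    by (intro dvd_sum six_dvd_cube_minus)
  then have "6 dvd int (divisor_sigma 3 N) - int (divisor_sigma 1 N)"
    by (simp add: divisor_sigma_def sum_subtractf)
  moreover have "6 dvd (int N ^ 2 - int N) * int (divisor_sigma 1 N)"
  proof -
    have "3 dvd (int N ^ 2 - int N) * int (divisor_sigma 1 N)"
    proof (cases "N mod 3 = 2")
      case True
      from three_dvd_divisor_sigma_1[OF this] have "3 dvd int (divisor_sigma 1 N)"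
        by presburger
      then show ?thesis by (rule dvd_mult)
    next
      case False
      then have "3 dvd int N \<or> 3 dvd int N - 1" by presburger
      then have "3 dvd int N * (int N - 1)" by auto
      then have "3 dvd int N ^ 2 - int N"
        by (simp add: power2_eq_square algebra_simps)
      then show ?thesis by (rule dvd_mult2)
    qed
    moreover have "2 dvd (int N ^ 2 - int N) * int (divisor_sigma 1 N)" by simp
    ultimately show ?thesis
      using divides_mult[of 3 _ "2::int"] by simp
  qed
  ultimately have "6 dvd (int N ^ 2 - int N) * int (divisor_sigma 1 N)
      - (int (divisor_sigma 3 N) - int (divisor_sigma 1 N))"
    by (rule dvd_diff[rotated])
  then show ?thesis by (simp add: algebra_simps)
qed

text \<open>The factor 3 comes from \<open>e * (e\<^sup>2 - 1)\<close>, available as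
  \<open>j \<ge> 1\<close>. For 8: if \<open>e\<close> is even, \<open>N = e * f\<close> turns
  \<open>N\<^sup>2 - e\<^sup>2\<close> into \<open>e\<^sup>2 * (f\<^sup>2 - 1)\<close>, so
  \<open>e ^ 3\<close> divides the product; if \<open>e\<close> is odd, 8 divides
  \<open>e\<^sup>2 - 1\<close>.\<close>

lemma twentyfour_dvd_b_k_summand:
  fixes e N :: int
  assumes "e dvd N" and "j \<ge> 1"
  shows "24 dvd e ^ j * ((e\<^sup>2 - 1) * (N\<^sup>2 - e\<^sup>2))"
proof -
  obtain i where i: "j = Suc i" using assms(2) by (cases j) auto
  have "3 dvd e * (e\<^sup>2 - 1) * (e ^ i * (N\<^sup>2 - e\<^sup>2))"
    using three_dvd_cube_minus by (rule dvd_mult2)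
  then have 3: "3 dvd e ^ j * ((e\<^sup>2 - 1) * (N\<^sup>2 - e\<^sup>2))" by (simp add: i mult_ac)
  have 8: "8 dvd e ^ j * ((e\<^sup>2 - 1) * (N\<^sup>2 - e\<^sup>2))"
  proof (cases "even e")
    case True
    obtain f where f: "N = e * f" using assms(1) ..
    have "2 ^ 3 dvd e ^ 3" using True by (rule dvd_power_same)
    then have "8 dvd e ^ 3 * (e ^ i * ((e\<^sup>2 - 1) * (f\<^sup>2 - 1)))" by (intro dvd_mult2) simp
    also have "\<dots> = e ^ j * ((e\<^sup>2 - 1) * (N\<^sup>2 - e\<^sup>2))"
      by (simp add: i f algebra_simps eval_nat_numeral)
    finally show ?thesis .
  next
    case False
    then obtain g where g: "e = 2 * g + 1" by (elim oddE)
    have "even (g * (g + 1))" by simp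
    then obtain h where "g * (g + 1) = 2 * h" by (elim evenE)
    then have "e\<^sup>2 - 1 = 8 * h" by (simp add: g power2_eq_square algebra_simps)
    then show ?thesis by simp
  qed
  have "coprime (3::int) (2 ^ 3)"
    by (rule coprime_power_right_iff[THEN iffD2]) simp
  with divides_mult[OF 3 8] show ?thesis by simp
qed

lemma twentyfour_dvd_b_k_numerator:
  assumes "j \<ge> 1"
  shows "(24::int) dvd - (int N ^ 2) * int (divisor_sigma j N)
    + (int N ^ 2 + 1) * int (divisor_sigma (j + 2) N) - int (divisor_sigma (j + 4) N)"
proof -
  have "24 dvd (\<Sum>e | e dvd N. int e ^ j * ((int e ^ 2 - 1) * (int N ^ 2 - int e ^ 2)))"
    using assms by (intro dvd_sum twentyfour_dvd_b_k_summand) auto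
  also have "(\<Sum>e | e dvd N. int e ^ j * ((int e ^ 2 - 1) * (int N ^ 2 - int e ^ 2)))
    = (\<Sum>e | e dvd N. - (int N ^ 2) * int e ^ j + (int N ^ 2 + 1) * int e ^ (j + 2) - int e ^ (j + 4))"
    by (intro sum.cong) (auto simp: algebra_simps eval_nat_numeral)
  finally show ?thesis
    by (simp add: divisor_sigma_def sum_subtractf sum.distrib sum_distrib_left sum_negf)
qed

lemma b_num_cong_0:
  assumes "prime p" and "p > 3" and "even k" and "k \<ge> 6"
    and sigma: "\<And>j. p dvd divisor_sigma j N"
  shows "\<exists>m::int. b_num k N = of_int m \<and> [m = 0] (mod int p)"
proof -
  have p_sigma: "int p dvd int (divisor_sigma j N)" for j
    using sigma by simp
  have "coprime p 2" "coprime p 3"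
    by (rule primes_coprime; use assms(1,2) in simp)+
  then have coprime: "coprime (int p) 6" "coprime (int p) 24"
    using coprime_mult_right_iff[of p 2 3] coprime_mult_right_iff[of p 3 "2 ^ 3"]
      coprime_power_right_iff[of p 2 3] coprime_int_iff[of p 6] coprime_int_iff[of p 24]
    by simp_all
  show ?thesis
  proof (cases "k = 6")
    case True
    define A where
      "A = (int N ^ 2 - int N + 1) * int (divisor_sigma 1 N) - int (divisor_sigma 3 N)"
    obtain m where m: "A = 6 * m"
      using six_dvd_b_6_numerator[of N] unfolding A_def by (rule dvdE)
    have "int p dvd A"
      unfolding A_def by (intro dvd_diff dvd_mult p_sigma)
    then have "int p dvd m"
      using m coprime by (simp add: coprime_dvd_mult_right_iff)
    moreover have "b_num k N = of_int A / 6"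
      by (simp add: True b_num_def A_def)
    ultimately show ?thesis
      using m by (auto simp: cong_0_iff)
  next
    case False
    define j where "j = k - 7"
    \<comment> \<open>Evenness excludes \<open>k = 7\<close>; from here on the truncated differences
      are genuine and \<open>j\<close> is positive.\<close>
    have "k \<ge> 8" using False assms(3,4) by presburger
    then have j: "j \<ge> 1" "k - 7 = j" "k - 5 = j + 2" "k - 3 = j + 4"
      by (auto simp: j_def)
    define A where "A = - (int N ^ 2) * int (divisor_sigma j N)
      + (int N ^ 2 + 1) * int (divisor_sigma (j + 2) N) - int (divisor_sigma (j + 4) N)"
    obtain m where m: "A = 24 * m"
      using twentyfour_dvd_b_k_numerator[OF j(1), of N] unfolding A_def by (rule dvdE)
    have "int p dvd A"
      unfolding A_def by (intro dvd_diff dvd_add dvd_mult p_sigma)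
    then have "int p dvd m"
      using m coprime by (simp add: coprime_dvd_mult_right_iff)
    moreover have "b_num k N = of_int A / 24"
      using False by (simp add: b_num_def A_def j)
    ultimately show ?thesis
      using m by (auto simp: cong_0_iff)
  qed
qed

theorem theorem5p3:
  fixes p d k n :: nat
  assumes "prime p" and "p > 3"
    and "d = ord p 2"
    and "even k" and "k \<ge> 6"
  shows "\<exists>m::int. b_num k (2 ^ (d * p) * n + 2 ^ (d * p - 1)) = of_int m \<and> [m = 0] (mod int p)"
proof (rule b_num_cong_0[OF assms(1,2,4,5)])
  fix j
  have "coprime p 2"
    by (rule primes_coprime) (use assms(1,2) in simp_all)
  \<comment> \<open>\<open>ord p 2\<close> would be 0 if 2 were not prime to \<open>p\<close>;
    positivity makes the exponent \<open>d * p - 1\<close> a true predecessor.\<close>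
  then have "d > 0" by (simp add: assms(3))
  then obtain a where a: "d * p = Suc a"
    using assms(2) by (cases "d * p") auto
  \<comment> \<open>\<open>d\<close> need only be a period of the powers of \<open>2 ^ j\<close>,
    not the exact order of \<open>2 ^ j\<close>.\<close>
  have "[(2 ^ d) ^ j = 1 ^ j] (mod p)"
    unfolding assms(3) by (intro cong_pow ord)
  then have "[(2 ^ j) ^ d = 1] (mod p)"
    by (simp add: mult.commute flip: power_mult)
  then have "p dvd (\<Sum>i\<le>a. (2 ^ j) ^ i)"
    using dvd_geometric_sum by (metis a lessThan_Suc_atMost)
  moreover have "2 ^ (d * p) * n + 2 ^ (d * p - 1) = 2 ^ a * (2 * n + 1)"
    by (simp add: a algebra_simps)
  moreover have "divisor_sigma j (2 ^ a * (2 * n + 1)) =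
      (\<Sum>i\<le>a. (2 ^ j) ^ i) * divisor_sigma j (2 * n + 1)"
    by (rule divisor_sigma_prime_power_mult) auto
  ultimately show "p dvd divisor_sigma j (2 ^ (d * p) * n + 2 ^ (d * p - 1))"
    by simp
qed

end
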